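(* Let $m\ge 1$ be an integer, let $0<\alpha<1/2$, and let $0=\beta_0<\beta_1<\cdots<\beta_m<\beta_{m+1}=1$ be real numbers. Put $M=\{0,\dots,m\}$, and let $B_0,\dots,B_m$, $I_0,\dots,I_m$ and $X_K$ ($K\subset M$) be the subsets of $[0,1[$ defined in the context. Let $i,j\in M$, let $K\subset M$, and let $x\in[0,1[$. If $x\in B_i$ and $x+\alpha \bmod 1\in B_j\cap X_K$, then $$j\equiv i+|K| \pmod{m+1}.$$
   Context: $[a,b[$ denotes a half-open interval. For $x,y\in[0,1[$, intervals are taken on the circle: $[x,y[=\{z\mid x\le z<y\}$ if $x<y$; $[x,y[=\emptyset$ if $x=y$; and $[x,y[=\{z\mid x\le z<1\}\cup\{z\mid 0\le z<y\}$ if $x>y$. For $k\in M$: $B_k=[\beta_k,\beta_{k+1}[$ (these sets partition $[0,1[$; the set $B_m=[\beta_m,1[$ is the usual real interval), and $I_k=[\beta_k,\beta_k+\alpha[$ where $\beta_k+\alpha$ is taken modulo $1$ in $[0,1[$. The complement of $I_k$ is $\overline{I_k}=[0,1[\setminus I_k$. For $K\subset M$, $X_K=\bigcap_{k\in K}I_k\cap\bigcap_{k\in M\setminus K}\overline{I_k}$. The cardinality of $K$ is $|K|$. *)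

theory Defs
  imports Complex_Main "HOL-Number_Theory.Cong"
begin

text \<open>
  The circle is the real interval \<open>{0..<1}\<close>; reduction modulo 1 into it is \<^term>\<open>frac\<close>.
\<close>

definition circle :: "real set" where
  "circle = {0..<1}"

text \<open>The arc $[x,y[$, meant for \<open>x, y \<in> circle\<close>.\<close>

definition arc :: "real \<Rightarrow> real \<Rightarrow> real set" where
  "arc x y = (if x < y then {z. x \<le> z \<and> z < y}
              else if x = y then {}
              else {z. x \<le> z \<and> z < 1} \<union> {z. 0 \<le> z \<and> z < y})"

text \<open>
  Usual real intervals: as $\beta$ is increasing, no \<open>B \<beta> k\<close> wraps around,
  and for $k = m$ the right end point is $\beta_{m+1} = 1$.
\<close>

definition B :: "(nat \<Rightarrow> real) \<Rightarrow> nat \<Rightarrow> real set" where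
  "B \<beta> k = {\<beta> k..<\<beta> (k + 1)}"

definition I :: "real \<Rightarrow> (nat \<Rightarrow> real) \<Rightarrow> nat \<Rightarrow> real set" where
  "I \<alpha> \<beta> k = arc (\<beta> k) (frac (\<beta> k + \<alpha>))"

text \<open>
  An intersection over the empty index set is \<^const>\<open>UNIV\<close>; since $M = \{0,\dots,m\}$ is nonempty,
  at least one of the two index sets is nonempty, and so \<open>X m \<alpha> \<beta> K\<close> is a subset of the circle.
\<close>

definition X :: "nat \<Rightarrow> real \<Rightarrow> (nat \<Rightarrow> real) \<Rightarrow> nat set \<Rightarrow> real set" where
  "X m \<alpha> \<beta> K = (\<Inter>k\<in>K. I \<alpha> \<beta> k) \<inter> (\<Inter>k\<in>{0..m} - K. circle - I \<alpha> \<beta> k)"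

end

theory Submission
  imports Defs
begin

text \<open>
  Moving from \<open>x\<close> to \<open>x + \<alpha>\<close> counterclockwise along the circle, one leaves \<open>B\<^sub>i\<close> and enters the
  next block, cyclically, each time one meets a point \<open>\<beta>\<^sub>k\<close>. So \<open>j\<close> is, modulo \<open>m + 1\<close>, the sum of
  \<open>i\<close> and the number of points \<open>\<beta>\<^sub>k\<close> that are met. But \<open>\<beta>\<^sub>k\<close> is met exactly if the way from it
  to the end point is shorter than \<open>\<alpha>\<close>, that is, if the end point is in \<open>I\<^sub>k\<close>
  (\<open>frac_add_mem_arc_iff\<close>), and the set of these \<open>k\<close> is \<open>K\<close>. For the count, \<open>K\<close> is determined
  explicitly: it is \<open>{i<..j}\<close> if the move does not pass the origin,
  and \<open>{i<..m} \<union> {..j}\<close> if it does.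
\<close>

lemma frac_add_eq_if:
  fixes x a :: real
  assumes "x \<in> circle" "0 < a" "a < 1"
  shows "frac (x + a) = (if x + a < 1 then x + a else x + a - 1)"
  using assms by (auto simp: frac_unique_iff circle_def)

text \<open>
  The arc of length \<open>a\<close> that starts at \<open>b\<close> contains \<open>x + a\<close> exactly if \<open>b\<close> lies on the arc from \<open>x\<close>
  (excluded) to \<open>x + a\<close> (included): both say that the way from \<open>b\<close> to \<open>x + a\<close> is shorter than \<open>a\<close>.
\<close>

lemma frac_add_mem_arc_iff:
  fixes x a b :: real
  assumes "x \<in> circle" "b \<in> circle" "0 < a" "a < 1"
  shows "frac (x + a) \<in> arc b (frac (b + a)) \<longleftrightarrow>
    (if x + a < 1 then x < b \<and> b \<le> x + a else x < b \<or> b \<le> x + a - 1)"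
  using assms by (auto simp: frac_add_eq_if arc_def circle_def)

lemma le_iff_of_mem_B:
  assumes mono: "strict_mono_on {0..n} \<beta>" and "i < n" "k \<le> n" "x \<in> B \<beta> i"
  shows "\<beta> k \<le> x \<longleftrightarrow> k \<le> i"
proof
  assume "k \<le> i"
  then have "\<beta> k \<le> \<beta> i"
    using assms by (intro strict_mono_on_leD[OF mono]) auto
  then show "\<beta> k \<le> x"
    using \<open>x \<in> B \<beta> i\<close> by (simp add: B_def)
next
  assume le: "\<beta> k \<le> x"
  show "k \<le> i"
  proof (rule ccontr)
    assume "\<not> k \<le> i"
    then have "\<beta> (i + 1) \<le> \<beta> k"
      using assms by (intro strict_mono_on_leD[OF mono]) auto
    then show False
      using le \<open>x \<in> B \<beta> i\<close> by (simp add: B_def)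
  qed
qed

theorem proposition6p1:
  fixes m i j :: nat and \<alpha> x :: real and \<beta> :: "nat \<Rightarrow> real" and K :: "nat set"
  assumes "m \<ge> 1"
    and "0 < \<alpha>" and "\<alpha> < 1 / 2"
    and "\<beta> 0 = 0" and "\<beta> (m + 1) = 1" and "strict_mono_on {0..m + 1} \<beta>"
    and "i \<in> {0..m}" and "j \<in> {0..m}" and "K \<subseteq> {0..m}"
    and "x \<in> circle"
    and "x \<in> B \<beta> i"
    and "frac (x + \<alpha>) \<in> B \<beta> j \<inter> X m \<alpha> \<beta> K"
  shows "[j = i + card K] (mod (m + 1))"
proof -
  define y where "y = frac (x + \<alpha>)"
  have y: "y = (if x + \<alpha> < 1 then x + \<alpha> else x + \<alpha> - 1)"
    using assms by (simp add: y_def frac_add_eq_if)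
  have le_x: "\<beta> k \<le> x \<longleftrightarrow> k \<le> i" and le_y: "\<beta> k \<le> y \<longleftrightarrow> k \<le> j" if "k \<le> m" for k
    using le_iff_of_mem_B[OF assms(6)] assms that by (auto simp: y_def)
  have \<beta>_circle: "\<beta> k \<in> circle" if "k \<le> m" for k
    using strict_mono_on_leD[OF assms(6), of 0 k] strict_mono_onD[OF assms(6), of k "m + 1"]
      assms(4,5) that by (simp add: circle_def)
  have K: "k \<in> K \<longleftrightarrow> (if x + \<alpha> < 1 then i < k \<and> k \<le> j else i < k \<or> k \<le> j)"
    if "k \<le> m" for k
  proof -
    have "k \<in> K \<longleftrightarrow> y \<in> I \<alpha> \<beta> k"
      using assms(12) atLeastAtMost_iff[of k 0 m] that unfolding X_def y_def by blast
    also have "\<dots> \<longleftrightarrow> (if x + \<alpha> < 1 then x < \<beta> k \<and> \<beta> k \<le> y else x < \<beta> k \<or> \<beta> k \<le> y)"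
      using frac_add_mem_arc_iff[OF assms(10) \<beta>_circle[OF that], of \<alpha>] assms(2,3) y
      by (auto simp: I_def y_def)
    also have "\<dots> \<longleftrightarrow> (if x + \<alpha> < 1 then i < k \<and> k \<le> j else i < k \<or> k \<le> j)"
      using le_x[OF that] le_y[OF that] by (auto simp: not_le[symmetric])
    finally show ?thesis .
  qed
  show ?thesis
  proof (cases "x + \<alpha> < 1")
    case True
    have "\<beta> i \<le> y"
      using le_x[of i] assms(2,7) y True by simp
    then have "i \<le> j"
      using le_y[of i] assms(7) by simp
    moreover have "K = {i<..j}"
      using K True assms(8,9) by (auto dest: subsetD)
    ultimately show ?thesis
      by simp
  next
    case False
    have "\<beta> j \<le> x"
      using le_y[of j] assms(3,8) y False by simp
    then have "j \<le> i"
      using le_x[of j] assms(8) by simp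
    have "K = {i<..m} \<union> {..j}"
      using K False assms(8,9) by (auto dest: subsetD)
    \<comment> \<open>As \<open>j \<le> i\<close>, the union is disjoint: the move is less than a full turn,
      so no point is met twice.\<close>
    then have "card K = (m - i) + (j + 1)"
      using \<open>j \<le> i\<close> by (subst \<open>K = _\<close>, subst card_Un_disjoint) auto
    then have "i + card K = j + (m + 1)"
      using assms(7) by simp
    then show ?thesis
      by (simp only: cong_def mod_add_self2)
  qed
qed

end
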